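(* For each $j\in\mathbb{N}$ let $\omega_j\colon I_j\subseteq\mathbb{R}\to\mathbb{R}$ be a weight function all of whose moments $a_{jk}=\int_{I_j}t^k\,\omega_j(t)\,dt$, $k\in\mathbb{N}$, exist, with $I_0=I_1$ and $\omega_0=\omega_1$. Let $\mathbf{E}\colon\mathbb{R}[x_0]\to\mathbb{R}$ be the linear functional $\mathbf{E}\,x_0^k=a_k:=a_{0k}=a_{1k}=\int_{I_1}t^k\omega_1(t)\,dt$, and assume $\mathbf{E}\,1\neq0$. For $1\le m\le n$ put $j(i)=1$ for $1\le i\le n-m+1$ and $j(i)=i-(n-m)$ for $n-m+2\le i\le n$. Then the set of polynomials $\{p_{nm}(x_0)\mid 1\le m\le n\}$ defined by $$p_{nm}(x_0)=\int_{I_{j(1)}\times I_{j(2)}\times\cdots\times I_{j(n)}}\Delta(x_1,x_2,\ldots,x_{n-m+1})\,\Delta(x_0,x_1,\ldots,x_n)\prod_{i=1}^{n}\omega_{j(i)}(x_i)\,dx_i$$ is a generalized orthogonal polynomial system for $\mathbf{E}$, provided that $\deg p_{nm}=n$ for all $1\leq m\leq n$.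
   Context: $\mathbb{N}$ and $\mathbb{P}$ are the sets of nonnegative and positive integers. Generalized orthogonal polynomial system: for a linear functional $\mathbf{E}\colon\mathbb{R}[x_0]\to\mathbb{R}$ with $\mathbf{E}\,1\ne0$, a set $\{p_{nm}(x_0)\mid n,m\in\mathbb{P},\,1\le m\le n\}$ of polynomials with $\deg p_{nm}=n$ for all $1\le m\le n$ is a generalized orthogonal polynomial system for $\mathbf{E}$ if for all $1\le m\le n$ $$\mathbf{E}\,x_0^k\,p_{nm}(x_0)=0\quad\text{for all }0\le k\le n-m.$$ Vandermonde polynomial: $\Delta(x_1,\ldots,x_N)=\prod_{1\le i<j\le N}(x_j-x_i)$, with $\Delta(x_1)=1$; similarly $\Delta(x_0,x_1,\ldots,x_n)=\prod_{0\le i<j\le n}(x_j-x_i)$. Existence of moments means that each $t^k\omega_j(t)$ is (Lebesgue) integrable on $I_j$. *)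

theory Defs
  imports "HOL-Analysis.Analysis" "HOL-Computational_Algebra.Polynomial"
begin

definition vandermonde :: "nat \<Rightarrow> nat \<Rightarrow> (nat \<Rightarrow> real) \<Rightarrow> real" where
  "vandermonde a b x = (\<Prod>(i, j) \<in> {(i, j). a \<le> i \<and> i < j \<and> j \<le> b}. x j - x i)"

text \<open>Only the values \<^term>\<open>p n m\<close> with \<^prop>\<open>1 \<le> m \<and> m \<le> n\<close> are relevant.\<close>

definition generalized_ops :: "(real poly \<Rightarrow> real) \<Rightarrow> (nat \<Rightarrow> nat \<Rightarrow> real poly) \<Rightarrow> bool" where
  "generalized_ops E p \<longleftrightarrow>
     Vector_Spaces.linear smult (*) E \<and> E 1 \<noteq> 0 \<and>
     (\<forall>n m. 1 \<le> m \<and> m \<le> n \<longrightarrow>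
        degree (p n m) = n \<and> (\<forall>k \<le> n - m. E (monom 1 k * p n m) = 0))"

definition weight_index :: "nat \<Rightarrow> nat \<Rightarrow> nat \<Rightarrow> nat" where
  "weight_index n m i = (if i \<le> n - m + 1 then 1 else i - (n - m))"

text \<open>The point \<open>(x\<^sub>0, x\<^sub>1, \<dots>, x\<^sub>n)\<close> is \<open>x(0 := x0)\<close>, where \<open>x\<close> carries the
  variables of integration with indices in \<open>{1..n}\<close>.\<close>

definition gop_integrand ::
    "(nat \<Rightarrow> real \<Rightarrow> real) \<Rightarrow> nat \<Rightarrow> nat \<Rightarrow> real \<Rightarrow> (nat \<Rightarrow> real) \<Rightarrow> real" where
  "gop_integrand \<omega> n m x0 x =
     vandermonde 1 (n - m + 1) x * vandermonde 0 n (x(0 := x0)) *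
     (\<Prod>i = 1..n. \<omega> (weight_index n m i) (x i))"

definition gop_domain :: "(nat \<Rightarrow> real set) \<Rightarrow> nat \<Rightarrow> nat \<Rightarrow> (nat \<Rightarrow> real) set" where
  "gop_domain I n m = (\<Pi>\<^sub>E i \<in> {1..n}. I (weight_index n m i))"

text \<open>The product of Lebesgue measures below is Lebesgue measure on \<open>n\<close>-space up to completion,
  which does not affect the integrals of product-measurable functions.\<close>

abbreviation lebesgue_pow :: "nat \<Rightarrow> (nat \<Rightarrow> real) measure" where
  "lebesgue_pow n \<equiv> PiM {1..n} (\<lambda>_. lebesgue)"

definition gop_value ::
    "(nat \<Rightarrow> real set) \<Rightarrow> (nat \<Rightarrow> real \<Rightarrow> real) \<Rightarrow> nat \<Rightarrow> nat \<Rightarrow> real \<Rightarrow> real" where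
  "gop_value I \<omega> n m x0 =
     set_lebesgue_integral (lebesgue_pow n) (gop_domain I n m) (gop_integrand \<omega> n m x0)"

text \<open>The polynomial in \<open>x\<^sub>0\<close> given by the integral. It is unique if it exists, since a real
  polynomial is determined by its values.\<close>

definition gop_poly ::
    "(nat \<Rightarrow> real set) \<Rightarrow> (nat \<Rightarrow> real \<Rightarrow> real) \<Rightarrow> nat \<Rightarrow> nat \<Rightarrow> real poly" where
  "gop_poly I \<omega> n m = (THE q. \<forall>x0. poly q x0 = gop_value I \<omega> n m x0)"

end

theory Submission
  imports Defs
begin

text \<open>
  Write \<open>N = n - m + 1\<close>, so that \<open>x\<^sub>1, \<dots>, x\<^sub>N\<close> all carry the weight that defines \<^term>\<open>E\<close>.
  Applying \<^term>\<open>E\<close> to \<open>x\<^sub>0\<^sup>k p\<^sub>n\<^sub>m\<close> integrates out \<open>x\<^sub>0\<close> against this weight too, so that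
  \<open>E (x\<^sub>0\<^sup>k p\<^sub>n\<^sub>m)\<close> is the integral \<open>J\<close> of
  \<open>x\<^sub>0\<^sup>k \<Delta>(x\<^sub>1, \<dots>, x\<^sub>N) \<Delta>(x\<^sub>0, \<dots>, x\<^sub>n)\<close> over \<open>n + 1\<close> variables, with equal weights on
  \<open>x\<^sub>0, \<dots>, x\<^sub>N\<close>.  Exchanging \<open>x\<^sub>0\<close> with \<open>x\<^sub>i\<close> for some \<open>1 \<le> i \<le> N\<close> preserves \<open>J\<close>, reverses the
  sign of the large Vandermonde product, and turns the rest of the integrand into
  \<open>x\<^sub>i\<^sup>k \<Delta>\<^sub>i\<close>, where \<open>\<Delta>\<^sub>i\<close> is \<open>\<Delta>(x\<^sub>1, \<dots>, x\<^sub>N)\<close> with \<open>x\<^sub>0\<close> in place of \<open>x\<^sub>i\<close>.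

  The quotients \<open>\<Delta>\<^sub>i / \<Delta>(x\<^sub>1, \<dots>, x\<^sub>N)\<close> are the Lagrange basis polynomials in \<open>x\<^sub>0\<close> for the nodes
  \<open>x\<^sub>1, \<dots>, x\<^sub>N\<close>.  Interpolation is exact on \<open>x\<^sub>0\<^sup>k\<close> for \<open>k < N\<close>, so that
  \<open>x\<^sub>0\<^sup>k \<Delta>(x\<^sub>1, \<dots>, x\<^sub>N) = \<Sum>\<^sub>i x\<^sub>i\<^sup>k \<Delta>\<^sub>i\<close> (lemma \<open>vandermonde_interpolation\<close>).  Summing over
  \<open>i\<close> gives \<open>N J = - J\<close>, and hence \<open>J = 0\<close> (lemma \<open>weighted_integral_kernel_eq_0\<close>).

  The analytic part is reduced to moments.  All integrands are polynomials times a product of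
  one-variable weights, and for a monomial the integral is a product of moments.  By linearity this
  yields integrability, the invariance under permuting variables of equal weight
  (\<open>weighted_integral_permute\<close>), and the passage from \<^term>\<open>E\<close> applied to a partial integral to a
  full integral (\<open>partial_weighted_integral\<close>).
\<close>

section \<open>Polynomial functions of finitely many variables\<close>

text \<open>The linear span of the monomials, given inductively so that a property which is linear in the
  polynomial has to be checked on monomials only.\<close>

inductive_set polyfuns :: "'i set \<Rightarrow> (('i \<Rightarrow> real) \<Rightarrow> real) set" for A where
  monomial: "(\<lambda>x. \<Prod>i\<in>A. x i ^ e i) \<in> polyfuns A"
| add: "f \<in> polyfuns A \<Longrightarrow> g \<in> polyfuns A \<Longrightarrow> (\<lambda>x. f x + g x) \<in> polyfuns A"
| scale: "f \<in> polyfuns A \<Longrightarrow> (\<lambda>x. c * f x) \<in> polyfuns A"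

lemma polyfuns_const: "(\<lambda>x. c) \<in> polyfuns A"
  using polyfuns.scale[OF polyfuns.monomial[of "\<lambda>_. 0" A], of c] by simp

lemma polyfuns_coord:
  assumes "finite A" "a \<in> A"
  shows "(\<lambda>x. x a) \<in> polyfuns A"
proof -
  have "(\<lambda>x. \<Prod>i\<in>A. x i ^ (if i = a then 1 else 0)) = (\<lambda>x :: 'a \<Rightarrow> real. x a)"
  proof
    fix x :: "'a \<Rightarrow> real"
    have "(\<Prod>i\<in>A. x i ^ (if i = a then 1 else 0)) = (\<Prod>i\<in>A. if i = a then x i else 1)"
      by (intro prod.cong) auto
    also have "\<dots> = x a"
      using assms by simp
    finally show "(\<Prod>i\<in>A. x i ^ (if i = a then 1 else 0)) = x a" .
  qed
  then show ?thesis
    using polyfuns.monomial[of "\<lambda>i. if i = a then 1 else 0" A] by simp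
qed

lemma polyfuns_diff:
  assumes "f \<in> polyfuns A" "g \<in> polyfuns A"
  shows "(\<lambda>x. f x - g x) \<in> polyfuns A"
  using polyfuns.add[OF assms(1) polyfuns.scale[OF assms(2), of "-1"]] by simp

lemma polyfuns_mult:
  assumes "f \<in> polyfuns A" "g \<in> polyfuns A"
  shows "(\<lambda>x. f x * g x) \<in> polyfuns A"
  using assms(1)
proof induction
  case (monomial d)
  show ?case
    using assms(2)
  proof induction
    case (monomial e)
    show ?case
      using polyfuns.monomial[of "\<lambda>i. d i + e i" A] by (simp add: power_add prod.distrib)
  next
    case (add f g)
    then show ?case
      using polyfuns.add[OF add.IH] by (simp add: algebra_simps)
  next
    case (scale f c)
    then show ?case
      using polyfuns.scale[OF scale.IH, of c] by (simp add: mult.left_commute)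
  qed
next
  case (add f h)
  then show ?case
    using polyfuns.add[OF add.IH] by (simp add: algebra_simps)
next
  case (scale f c)
  then show ?case
    using polyfuns.scale[OF scale.IH, of c] by (simp add: mult.assoc)
qed

lemma polyfuns_prod:
  "(\<And>s. s \<in> S \<Longrightarrow> f s \<in> polyfuns A) \<Longrightarrow> (\<lambda>x. \<Prod>s\<in>S. f s x) \<in> polyfuns A"
  by (induction S rule: infinite_finite_induct) (simp_all add: polyfuns_const polyfuns_mult)

lemma polyfuns_power: "f \<in> polyfuns A \<Longrightarrow> (\<lambda>x. f x ^ k) \<in> polyfuns A"
  using polyfuns_prod[of "{..<k}" "\<lambda>_. f" A] by simp

lemma polyfuns_comp_coords:
  assumes "finite B" "f \<in> polyfuns A" "\<And>i. i \<in> A \<Longrightarrow> \<pi> i \<in> B"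
  shows "(\<lambda>x. f (\<lambda>i. x (\<pi> i))) \<in> polyfuns B"
  using assms(2)
proof induction
  case (monomial e)
  show ?case
    by (intro polyfuns_prod polyfuns_power polyfuns_coord assms)
qed (rule polyfuns.add polyfuns.scale, assumption+)+

lemma prod_power_update:
  fixes x :: "'i \<Rightarrow> real"
  assumes "finite A" "z \<notin> A"
  shows "(\<Prod>i\<in>insert z A. (x(z := t)) i ^ e i) = t ^ e z * (\<Prod>i\<in>A. x i ^ e i)"
proof -
  have "(\<Prod>i\<in>A. (x(z := t)) i ^ e i) = (\<Prod>i\<in>A. x i ^ e i)"
    using assms(2) by (intro prod.cong) auto
  then show ?thesis
    using assms by simp
qed

lemma polyfuns_update:
  assumes "finite A" "z \<notin> A" "g \<in> polyfuns (insert z A)"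
  shows "(\<lambda>x. g (x(z := t))) \<in> polyfuns A"
  using assms(3)
proof induction
  case (monomial e)
  show ?case
    unfolding prod_power_update[OF assms(1,2)] by (intro polyfuns.scale polyfuns.monomial)
qed (rule polyfuns.add polyfuns.scale, assumption+)+


section \<open>Integration against a product of weights\<close>

lemma sigma_finite_lebesgue: "sigma_finite_measure (lebesgue :: real measure)"
proof
  have "(\<Union>n. cball (0 :: real) (real n)) = UNIV"
    by (auto simp: real_arch_simple)
  then show "\<exists>A. countable A \<and> A \<subseteq> sets (lebesgue :: real measure) \<and> \<Union>A = space lebesgue \<and>
      (\<forall>a\<in>A. emeasure lebesgue a \<noteq> \<infinity>)"
    by (intro exI[of _ "range (\<lambda>n. cball (0 :: real) (real n))"])
      (use emeasure_lborel_cball_finite[where 'a = real] in \<open>auto simp: less_top\<close>)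
qed

text \<open>The weights are defined on the whole line: a weight on a smaller domain is extended by
  zero.\<close>

locale weights_with_moments =
  fixes F :: "'i \<Rightarrow> real \<Rightarrow> real"
  assumes integrable_moment: "\<And>i k. integrable lebesgue (\<lambda>t. t ^ k * F i t)"
begin

definition moment :: "'i \<Rightarrow> nat \<Rightarrow> real" where
  "moment i k = (LINT t|lebesgue. t ^ k * F i t)"

definition weighted_integral :: "'i set \<Rightarrow> (('i \<Rightarrow> real) \<Rightarrow> real) \<Rightarrow> real" where
  "weighted_integral A g = (LINT x|PiM A (\<lambda>_. lebesgue). g x * (\<Prod>i\<in>A. F i (x i)))"

sublocale product_sigma_finite "\<lambda>_ :: 'i. lebesgue :: real measure"
  by (simp add: product_sigma_finite_def sigma_finite_lebesgue)

lemma integrable_polyfun: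
  assumes "finite A" "g \<in> polyfuns A"
  shows "integrable (PiM A (\<lambda>_. lebesgue)) (\<lambda>x. g x * (\<Prod>i\<in>A. F i (x i)))"
  using assms(2)
proof induction
  case (monomial e)
  show ?case
    using product_integrable_prod[OF assms(1) integrable_moment, of e "\<lambda>i. i"]
    by (simp add: prod.distrib)
qed (simp_all add: distrib_right mult.assoc)

lemma weighted_integral_monomial:
  assumes "finite A"
  shows "weighted_integral A (\<lambda>x. \<Prod>i\<in>A. x i ^ e i) = (\<Prod>i\<in>A. moment i (e i))"
  unfolding weighted_integral_def moment_def
  using product_integral_prod[OF assms integrable_moment, of e "\<lambda>i. i"]
  by (simp add: prod.distrib)

lemma weighted_integral_add:
  assumes "finite A" "f \<in> polyfuns A" "g \<in> polyfuns A"
  shows "weighted_integral A (\<lambda>x. f x + g x) = weighted_integral A f + weighted_integral A g"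
  unfolding weighted_integral_def
  using integrable_polyfun[OF assms(1,2)] integrable_polyfun[OF assms(1,3)]
  by (simp add: distrib_right)

lemma weighted_integral_scale: "weighted_integral A (\<lambda>x. c * f x) = c * weighted_integral A f"
  unfolding weighted_integral_def by (simp add: mult.assoc)

lemma weighted_integral_sum:
  assumes "finite A" "\<And>s. s \<in> S \<Longrightarrow> f s \<in> polyfuns A"
  shows "weighted_integral A (\<lambda>x. \<Sum>s\<in>S. f s x) = (\<Sum>s\<in>S. weighted_integral A (f s))"
  unfolding weighted_integral_def
  using integrable_polyfun[OF assms(1) assms(2)]
  by (simp add: sum_distrib_right)

text \<open>On a monomial the permutation only reorders the factors in the product of moments.\<close>

lemma weighted_integral_permute:
  assumes "finite A" "g \<in> polyfuns A" "\<pi> permutes A" "\<And>i. i \<in> A \<Longrightarrow> F (\<pi> i) = F i"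
  shows "weighted_integral A (\<lambda>x. g (\<lambda>i. x (\<pi> i))) = weighted_integral A g"
  using assms(2)
proof induction
  case (monomial e)
  have "weighted_integral A (\<lambda>x. \<Prod>i\<in>A. x (\<pi> i) ^ e i)
      = weighted_integral A (\<lambda>x. \<Prod>i\<in>A. x i ^ e (inv \<pi> i))"
  proof (rule arg_cong[where f = "weighted_integral A"], rule ext)
    fix x :: "'i \<Rightarrow> real"
    show "(\<Prod>i\<in>A. x (\<pi> i) ^ e i) = (\<Prod>i\<in>A. x i ^ e (inv \<pi> i))"
      using prod.permute[OF assms(3), of "\<lambda>i. x i ^ e (inv \<pi> i)"]
      by (simp add: o_def permutes_inverses[OF assms(3)])
  qed
  also have "\<dots> = (\<Prod>i\<in>A. moment i (e (inv \<pi> i)))"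
    by (rule weighted_integral_monomial) fact
  also have "\<dots> = (\<Prod>i\<in>A. moment (\<pi> i) (e i))"
    using prod.permute[OF assms(3), of "\<lambda>i. moment i (e (inv \<pi> i))"]
    by (simp add: o_def permutes_inverses[OF assms(3)])
  also have "\<dots> = (\<Prod>i\<in>A. moment i (e i))"
    using assms(4) by (intro prod.cong) (simp_all add: moment_def)
  also have "\<dots> = weighted_integral A (\<lambda>x. \<Prod>i\<in>A. x i ^ e i)"
    using weighted_integral_monomial[OF assms(1)] by simp
  finally show ?case .
next
  case (add f g)
  have *: "(\<lambda>x. h (\<lambda>i. x (\<pi> i))) \<in> polyfuns A" if "h \<in> polyfuns A" for h
    by (rule polyfuns_comp_coords[OF assms(1) that]) (simp add: permutes_in_image[OF assms(3)])
  show ?case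
    using add by (simp add: weighted_integral_add assms(1) *)
next
  case (scale f c)
  then show ?case by (simp add: weighted_integral_scale)
qed

text \<open>Integrating out all variables but \<open>x\<^sub>z\<close> leaves a polynomial \<open>q\<close> in \<open>x\<^sub>z\<close>; since \<open>E\<close> is
  integration against the weight of \<open>x\<^sub>z\<close>, applying it to \<open>q\<close> completes the multiple integral.
  The induction needs both facts about the same \<open>q\<close>, and the power \<open>x\<^sub>z\<^sup>k\<close> stays outside \<open>g\<close> because
  \<open>q\<close> must not depend on \<open>k\<close>.\<close>

lemma partial_weighted_integral:
  fixes E :: "real poly \<Rightarrow> real"
  assumes "finite A" "z \<notin> A" "g \<in> polyfuns (insert z A)"
    and E: "Vector_Spaces.linear smult (*) E" "\<And>k. E (monom 1 k) = moment z k"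
  shows "\<exists>q. (\<forall>t. poly q t = weighted_integral A (\<lambda>x. g (x(z := t)))) \<and>
             (\<forall>k. E (monom 1 k * q) = weighted_integral (insert z A) (\<lambda>x. x z ^ k * g x))"
  using assms(3)
proof induction
  interpret E: Vector_Spaces.linear smult "(*)" E by fact
  case (monomial e)
  let ?c = "\<Prod>i\<in>A. moment i (e i)"
  have "poly (monom ?c (e z)) t
      = weighted_integral A (\<lambda>x. \<Prod>i\<in>insert z A. (x(z := t)) i ^ e i)" for t
    unfolding prod_power_update[OF assms(1,2)] by (simp add: poly_monom weighted_integral_scale
        weighted_integral_monomial[OF assms(1)])
  moreover have "E (monom 1 k * monom ?c (e z))
      = weighted_integral (insert z A) (\<lambda>x. x z ^ k * (\<Prod>i\<in>insert z A. x i ^ e i))" for k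
  proof -
    let ?e = "e(z := k + e z)"
    have "(\<Prod>i\<in>A. x i ^ ?e i) = (\<Prod>i\<in>A. x i ^ e i)" for x :: "'i \<Rightarrow> real"
      using assms(2) by (intro prod.cong) auto
    then have "(\<lambda>x. x z ^ k * (\<Prod>i\<in>insert z A. x i ^ e i))
        = (\<lambda>x :: 'i \<Rightarrow> real. \<Prod>i\<in>insert z A. x i ^ ?e i)"
      using assms by (simp add: power_add mult.assoc)
    then have "weighted_integral (insert z A) (\<lambda>x. x z ^ k * (\<Prod>i\<in>insert z A. x i ^ e i))
        = (\<Prod>i\<in>insert z A. moment i (?e i))"
      using weighted_integral_monomial[of "insert z A" ?e] assms by simp
    also have "\<dots> = moment z (k + e z) * ?c"
    proof -
      have "(\<Prod>i\<in>A. moment i (?e i)) = ?c"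
        using assms(2) by (intro prod.cong) auto
      then show ?thesis
        using assms by simp
    qed
    also have "\<dots> = E (smult ?c (monom 1 (k + e z)))"
      unfolding E.scale E(2) by simp
    also have "\<dots> = E (monom 1 k * monom ?c (e z))"
      by (simp add: mult_monom smult_monom)
    finally show ?thesis ..
  qed
  ultimately show ?case by blast
next
  interpret E: Vector_Spaces.linear smult "(*)" E by fact
  case (add f g)
  then obtain p q where
    p: "\<And>t. poly p t = weighted_integral A (\<lambda>x. f (x(z := t)))"
       "\<And>k. E (monom 1 k * p) = weighted_integral (insert z A) (\<lambda>x. x z ^ k * f x)" and
    q: "\<And>t. poly q t = weighted_integral A (\<lambda>x. g (x(z := t)))"
       "\<And>k. E (monom 1 k * q) = weighted_integral (insert z A) (\<lambda>x. x z ^ k * g x)"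
    by blast
  have *: "(\<lambda>x. x z ^ k * h x) \<in> polyfuns (insert z A)" if "h \<in> polyfuns (insert z A)" for h k
    using that assms(1) by (intro polyfuns_mult polyfuns_power polyfuns_coord) auto
  have "poly (p + q) t = weighted_integral A (\<lambda>x. f (x(z := t)) + g (x(z := t)))" for t
    using polyfuns_update[OF assms(1,2) add.hyps(1)] polyfuns_update[OF assms(1,2) add.hyps(2)]
    by (simp add: p q weighted_integral_add assms(1))
  moreover have "E (monom 1 k * (p + q))
      = weighted_integral (insert z A) (\<lambda>x. x z ^ k * (f x + g x))" for k
    using *[OF add.hyps(1)] *[OF add.hyps(2)] assms(1)
    by (simp add: distrib_left E.add p q weighted_integral_add)
  ultimately show ?case by blast
next
  interpret E: Vector_Spaces.linear smult "(*)" E by fact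
  case (scale f c)
  then obtain p where
    p: "\<And>t. poly p t = weighted_integral A (\<lambda>x. f (x(z := t)))"
       "\<And>k. E (monom 1 k * p) = weighted_integral (insert z A) (\<lambda>x. x z ^ k * f x)"
    by blast
  have "poly (smult c p) t = weighted_integral A (\<lambda>x. c * f (x(z := t)))" for t
    by (simp add: p weighted_integral_scale)
  moreover have "E (monom 1 k * smult c p)
      = weighted_integral (insert z A) (\<lambda>x. x z ^ k * (c * f x))" for k
    by (simp add: E.scale p mult.left_commute[of _ c] weighted_integral_scale)
  ultimately show ?case by blast
qed

end


section \<open>The Vandermonde product\<close>

lemma finite_pairs: "finite {(i, j). a \<le> i \<and> i < j \<and> j \<le> (b::nat)}"
  by (rule finite_subset[of _ "{..b} \<times> {..b}"]) auto

lemma vandermonde_cong: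
  "(\<And>i. a \<le> i \<Longrightarrow> i \<le> b \<Longrightarrow> x i = y i) \<Longrightarrow> vandermonde a b x = vandermonde a b y"
  unfolding vandermonde_def by (intro prod.cong) auto

lemma vandermonde_eq_0:
  assumes "a \<le> i" "i < j" "j \<le> b" "x i = x j"
  shows "vandermonde a b x = 0"
  unfolding vandermonde_def
  using assms by (intro prod_zero[OF finite_pairs] bexI[of _ "(i, j)"]) auto

lemma vandermonde_not_inj:
  assumes "\<not> inj_on x {a..b}"
  shows "vandermonde a b x = 0"
proof -
  obtain i j where "i \<in> {a..b}" "j \<in> {a..b}" "i < j" "x i = x j"
    using assms unfolding inj_on_def by (metis linorder_neqE_nat)
  then show ?thesis
    by (intro vandermonde_eq_0[of a i j]) auto
qed

lemma vandermonde_polyfun: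
  assumes "finite A" "{a..b} \<subseteq> A"
  shows "vandermonde a b \<in> polyfuns A"
proof -
  have "(\<lambda>x. \<Prod>p\<in>{(i, j). a \<le> i \<and> i < j \<and> j \<le> b}. x (snd p) - x (fst p)) \<in> polyfuns A"
    using assms by (intro polyfuns_prod polyfuns_diff polyfuns_coord) auto
  also have "(\<lambda>x. \<Prod>p\<in>{(i, j). a \<le> i \<and> i < j \<and> j \<le> b}. x (snd p) - x (fst p))
      = vandermonde a b"
    by (simp add: vandermonde_def fun_eq_iff case_prod_unfold)
  finally show ?thesis .
qed

text \<open>An adjacent transposition permutes the pairs \<open>j < k\<close> other than \<open>(i, i + 1)\<close> and keeps each of
  them increasing, so only the factor of \<open>(i, i + 1)\<close> changes its sign.\<close>

lemma vandermonde_adjacent: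
  assumes "a \<le> i" "Suc i \<le> b"
  shows "vandermonde a b (x \<circ> Transposition.transpose i (Suc i)) = - vandermonde a b x"
proof -
  let ?\<tau> = "Transposition.transpose i (Suc i)"
  let ?P = "{(j, k). a \<le> j \<and> j < k \<and> k \<le> b}"
  let ?Q = "?P - {(i, Suc i)}"
  have mem: "(i, Suc i) \<in> ?P"
    using assms by simp
  have "(\<Prod>(j, k)\<in>?Q. (x \<circ> ?\<tau>) k - (x \<circ> ?\<tau>) j) = (\<Prod>(j, k)\<in>?Q. x k - x j)"
    using assms
    by (intro prod.reindex_bij_witness[of _ "map_prod ?\<tau> ?\<tau>" "map_prod ?\<tau> ?\<tau>"])
      (auto simp: Transposition.transpose_def split: if_splits)
  then show ?thesis
    unfolding vandermonde_def prod.remove[OF finite_pairs mem] by (simp add: algebra_simps)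
qed

text \<open>A transposition is a conjugate of a shorter one by an adjacent one, and the two additional
  signs cancel.\<close>

lemma vandermonde_transpose:
  assumes "a \<le> i" "i < j" "j \<le> b"
  shows "vandermonde a b (x \<circ> Transposition.transpose i j) = - vandermonde a b x"
proof -
  have "Suc i \<le> j" using assms by simp
  then show ?thesis
    using assms(3)
  proof (induction j arbitrary: x rule: dec_induct)
    case base
    then show ?case using assms(1) by (intro vandermonde_adjacent) auto
  next
    case (step j)
    let ?\<tau> = "Transposition.transpose j (Suc j)" and ?\<sigma> = "Transposition.transpose i j"
    have "Transposition.transpose i (Suc j) = ?\<tau> \<circ> ?\<sigma> \<circ> ?\<tau>"
      using step.hyps by (auto simp: fun_eq_iff Transposition.transpose_def)
    then have "vandermonde a b (x \<circ> Transposition.transpose i (Suc j))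
        = vandermonde a b (((x \<circ> ?\<tau>) \<circ> ?\<sigma>) \<circ> ?\<tau>)"
      by (simp add: comp_assoc)
    also have "\<dots> = - vandermonde a b ((x \<circ> ?\<tau>) \<circ> ?\<sigma>)"
      using assms(1) step by (intro vandermonde_adjacent) auto
    also have "\<dots> = vandermonde a b (x \<circ> ?\<tau>)"
      by (subst step.IH) (use step.prems in simp_all)
    also have "\<dots> = - vandermonde a b x"
      using assms(1) step by (intro vandermonde_adjacent) auto
    finally show ?case .
  qed
qed

text \<open>The variable \<open>x\<^sub>i\<close> occurs in one linear factor for each of the other \<open>b - a\<close> indices; the
  factors without it form the constant \<open>c\<close> of the proof.\<close>

lemma vandermonde_as_poly:
  assumes "i \<in> {a..b}"
  obtains p where "degree p \<le> b - a" "\<And>t. poly p t = vandermonde a b (x(i := t))"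
proof -
  let ?R = "{(j, k). a \<le> j \<and> j < k \<and> k \<le> b \<and> j \<noteq> i \<and> k \<noteq> i}"
  define c where "c = (\<Prod>(j, k)\<in>?R. x k - x j)"
  define p where "p = smult c ((\<Prod>j\<in>{a..<i}. [:- x j, 1:]) * (\<Prod>k\<in>{i<..b}. [:x k, -1:]))"
  have "degree ((\<Prod>j\<in>{a..<i}. [:- x j, 1:]) * (\<Prod>k\<in>{i<..b}. [:x k, -1:])) = b - a"
    using assms by (simp add: degree_mult_eq degree_prod_sum_eq)
  then have "degree p \<le> b - a"
    unfolding p_def using degree_smult_le by metis
  moreover have "poly p t = vandermonde a b (x(i := t))" for t
  proof -
    let ?y = "x(i := t)"
    let ?S = "(\<lambda>j. (j, i)) ` {a..<i}" and ?T = "(\<lambda>k. (i, k)) ` {i<..b}"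
    have "finite ?R"
      by (rule finite_subset[OF _ finite_pairs[of a b]]) auto
    moreover have "{(j, k). a \<le> j \<and> j < k \<and> k \<le> b} = ?R \<union> (?S \<union> ?T)"
      using assms by auto
    ultimately have "vandermonde a b ?y = (\<Prod>(j, k)\<in>?R. ?y k - ?y j) *
        ((\<Prod>(j, k)\<in>?S. ?y k - ?y j) * (\<Prod>(j, k)\<in>?T. ?y k - ?y j))"
      unfolding vandermonde_def by (simp, subst prod.union_disjoint; (subst prod.union_disjoint)?; auto)
    also have "(\<Prod>(j, k)\<in>?R. ?y k - ?y j) = c"
      unfolding c_def by (intro prod.cong) auto
    also have "(\<Prod>(j, k)\<in>?S. ?y k - ?y j) = (\<Prod>j\<in>{a..<i}. t - x j)"
      by (subst prod.reindex) (auto simp: inj_on_def intro!: prod.cong)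
    also have "(\<Prod>(j, k)\<in>?T. ?y k - ?y j) = (\<Prod>k\<in>{i<..b}. x k - t)"
      by (subst prod.reindex) (auto simp: inj_on_def intro!: prod.cong)
    finally show ?thesis
      by (simp add: p_def poly_prod del: fun_upd_apply)
  qed
  ultimately show thesis by (rule that)
qed

text \<open>This is Lagrange interpolation of \<open>t\<^sup>k\<close> at the nodes \<open>x\<^sub>a, \<dots>, x\<^sub>b\<close>, with denominators cleared by
  the Vandermonde product.  Both sides are polynomials in \<open>t\<close> of degree at most \<open>b - a\<close>, and at the
  node \<open>t = x\<^sub>l\<close> every summand but that of \<open>l\<close> has a repeated argument and vanishes.\<close>

lemma vandermonde_interpolation:
  assumes "inj_on x {a..b}" "a \<le> b" "k \<le> b - a"
  shows "t ^ k * vandermonde a b x = (\<Sum>i = a..b. x i ^ k * vandermonde a b (x(i := t)))"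
proof -
  have "\<exists>p. degree p \<le> b - a \<and> (\<forall>t. poly p t = vandermonde a b (x(i := t)))"
    if "i \<in> {a..b}" for i
    using vandermonde_as_poly[OF that] by metis
  then obtain p where p: "\<And>i. i \<in> {a..b} \<Longrightarrow> degree (p i) \<le> b - a"
    "\<And>i t. i \<in> {a..b} \<Longrightarrow> poly (p i) t = vandermonde a b (x(i := t))"
    by metis
  define q where "q = (\<Sum>i = a..b. smult (x i ^ k) (p i))"
  define r where "r = monom (vandermonde a b x) k"
  have poly_q: "poly q t = (\<Sum>i = a..b. x i ^ k * vandermonde a b (x(i := t)))" for t
    by (simp add: q_def poly_sum p)
  have "r = q"
  proof (rule poly_eqI_degree[where A = "x ` {a..b}"])
    fix s
    assume "s \<in> x ` {a..b}"
    then obtain l where l: "l \<in> {a..b}" "s = x l" by blast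
    have "x i ^ k * vandermonde a b (x(i := s)) = (if i = l then s ^ k * vandermonde a b x else 0)"
      if "i \<in> {a..b}" for i
    proof (cases "i = l")
      case False
      then have "\<not> inj_on (x(i := s)) {a..b}"
        using that l unfolding inj_on_def by (metis fun_upd_other fun_upd_same)
      then show ?thesis
        using False by (simp add: vandermonde_not_inj)
    qed (simp add: l)
    then have "poly q s = (\<Sum>i = a..b. if i = l then s ^ k * vandermonde a b x else 0)"
      unfolding poly_q by (intro sum.cong) auto
    also have "\<dots> = poly r s"
      using l by (simp add: r_def poly_monom)
    finally show "poly r s = poly q s" ..
  next
    have "degree r \<le> b - a"
      unfolding r_def using degree_monom_le assms(3) by (metis order_trans)
    then show "degree r < card (x ` {a..b})"
      using assms by (simp add: card_image)
    have "degree q \<le> b - a"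
      unfolding q_def using p(1) degree_smult_le by (intro degree_sum_le) (auto intro: order_trans)
    then show "degree q < card (x ` {a..b})"
      using assms by (simp add: card_image)
  qed
  then show ?thesis
    using poly_q[of t] by (simp add: r_def poly_monom mult.commute flip: \<open>r = q\<close>)
qed


section \<open>The orthogonality relations\<close>

text \<open>The polynomial factor of the integrand, as a function of all of \<open>x\<^sub>0, \<dots>, x\<^sub>n\<close>, so that \<open>x\<^sub>0\<close> can
  be exchanged with the variables of integration.\<close>

definition vandermonde_kernel :: "nat \<Rightarrow> nat \<Rightarrow> (nat \<Rightarrow> real) \<Rightarrow> real" where
  "vandermonde_kernel N n x = vandermonde 1 N x * vandermonde 0 n x"

lemma vandermonde_kernel_polyfun: "N \<le> n \<Longrightarrow> vandermonde_kernel N n \<in> polyfuns {0..n}"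
  unfolding vandermonde_kernel_def by (intro polyfuns_mult vandermonde_polyfun) auto

lemma vandermonde_kernel_exchange:
  assumes "i \<in> {1..N}" "N \<le> n"
  shows "vandermonde_kernel N n (x \<circ> Transposition.transpose 0 i)
    = - (vandermonde 1 N (x(i := x 0)) * vandermonde 0 n x)"
proof -
  have "vandermonde 1 N (x \<circ> Transposition.transpose 0 i) = vandermonde 1 N (x(i := x 0))"
    by (intro vandermonde_cong) (auto simp: Transposition.transpose_def)
  moreover have "vandermonde 0 n (x \<circ> Transposition.transpose 0 i) = - vandermonde 0 n x"
    using assms by (intro vandermonde_transpose) auto
  ultimately show ?thesis
    by (simp add: vandermonde_kernel_def)
qed

text \<open>Exchanging \<open>x\<^sub>0\<close> with each of \<open>x\<^sub>1, \<dots>, x\<^sub>N\<close> in turn and summing with the interpolation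
  identity shows that the integral equals \<open>- 1 / N\<close> times itself.\<close>

lemma weighted_integral_kernel_eq_0:
  assumes "weights_with_moments F" "1 \<le> N" "N \<le> n" "k < N"
    and F: "\<And>i. i \<in> {1..N} \<Longrightarrow> F i = F 0"
  shows "weights_with_moments.weighted_integral F {0..n}
    (\<lambda>x. x 0 ^ k * vandermonde_kernel N n x) = 0"
proof -
  interpret weights_with_moments F by fact
  let ?g = "\<lambda>x :: nat \<Rightarrow> real. x 0 ^ k * vandermonde_kernel N n x"
  let ?h = "\<lambda>i x :: nat \<Rightarrow> real. x i ^ k * vandermonde_kernel N n (x \<circ> Transposition.transpose 0 i)"
  have g: "?g \<in> polyfuns {0..n}"
    using assms by (intro polyfuns_mult polyfuns_power polyfuns_coord vandermonde_kernel_polyfun) auto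
  have perm: "Transposition.transpose 0 i permutes {0..n}" if "i \<in> {1..N}" for i
    using that assms(3) by (intro permutes_swap_id) auto
  have h: "?h i \<in> polyfuns {0..n}" if "i \<in> {1..N}" for i
    using polyfuns_comp_coords[OF _ g, of "{0..n}" "Transposition.transpose 0 i"]
      perm[OF that, THEN permutes_in_image]
    by (simp add: o_def)
  have swap: "weighted_integral {0..n} (?h i) = weighted_integral {0..n} ?g" if "i \<in> {1..N}" for i
    using weighted_integral_permute[OF _ g perm[OF that]] F that
    by (simp add: o_def Transposition.transpose_def)
  have "(\<Sum>i = 1..N. ?h i x) = - ?g x" for x
  proof -
    have "(\<Sum>i = 1..N. ?h i x)
        = - ((\<Sum>i = 1..N. x i ^ k * vandermonde 1 N (x(i := x 0))) * vandermonde 0 n x)"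
      using assms(3)
      by (simp add: vandermonde_kernel_exchange sum_negf sum_distrib_right mult.assoc)
    \<comment> \<open>Interpolation needs distinct nodes; otherwise the large Vandermonde product vanishes.\<close>
    also have "\<dots> = - ?g x"
    proof (cases "inj_on x {0..n}")
      case True
      then have "inj_on x {1..N}"
        by (rule inj_on_subset) (use assms(3) in auto)
      then show ?thesis
        using vandermonde_interpolation[of x 1 N k "x 0"] assms
        by (simp add: vandermonde_kernel_def mult.assoc)
    qed (simp add: vandermonde_not_inj vandermonde_kernel_def)
    finally show ?thesis .
  qed
  then have "- weighted_integral {0..n} ?g = weighted_integral {0..n} (\<lambda>x. \<Sum>i = 1..N. ?h i x)"
    using weighted_integral_scale[of "{0..n}" "-1" ?g] by simp
  also have "\<dots> = (\<Sum>i = 1..N. weighted_integral {0..n} (?h i))"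
    by (rule weighted_integral_sum) (auto intro: h)
  also have "\<dots> = real N * weighted_integral {0..n} ?g"
    by (simp add: swap)
  finally have "real (Suc N) * weighted_integral {0..n} ?g = 0"
    by (simp add: distrib_right)
  then show ?thesis
    by (simp del: of_nat_Suc)
qed

theorem theorem6:
  fixes I :: "nat \<Rightarrow> real set"
    and \<omega> :: "nat \<Rightarrow> real \<Rightarrow> real"
    and E :: "real poly \<Rightarrow> real"
  assumes moments: "\<And>j k. set_integrable lebesgue (I j) (\<lambda>t. t ^ k * \<omega> j t)"
    and I01: "I 0 = I 1"
    and \<omega>01: "\<And>t. t \<in> I 1 \<Longrightarrow> \<omega> 0 t = \<omega> 1 t"
    and E_linear: "Vector_Spaces.linear smult (*) E"
    and E_moments: "\<And>k. E (monom 1 k) = set_lebesgue_integral lebesgue (I 1) (\<lambda>t. t ^ k * \<omega> 1 t)"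
    and E_1: "E 1 \<noteq> 0"
  shows "(\<forall>n m. 1 \<le> m \<and> m \<le> n \<longrightarrow>
            (\<forall>x0. set_integrable (lebesgue_pow n) (gop_domain I n m) (gop_integrand \<omega> n m x0) \<and>
                  poly (gop_poly I \<omega> n m) x0 = gop_value I \<omega> n m x0)) \<and>
         ((\<forall>n m. 1 \<le> m \<and> m \<le> n \<longrightarrow> degree (gop_poly I \<omega> n m) = n) \<longrightarrow>
            generalized_ops E (gop_poly I \<omega>))"
proof -
  define F where "F n m i t = indicator (I (weight_index n m i)) t * \<omega> (weight_index n m i) t"
    for n m i t
  define g where "g n m = vandermonde_kernel (n - m + 1) n" for n m :: nat
  have F: "weights_with_moments (F n m)" for n m
  proof
    fix i k
    show "integrable lebesgue (\<lambda>t. t ^ k * F n m i t)"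
      using moments[of "weight_index n m i" k]
      by (simp add: set_integrable_def F_def mult.left_commute)
  qed
  \<comment> \<open>The truncated subtraction in the index function makes it \<open>1\<close> at \<open>0\<close> also, so that the family
    \<open>F\<close> assigns to \<open>x\<^sub>0\<close> the weight that defines \<open>E\<close>.\<close>
  have E: "E (monom 1 k) = weights_with_moments.moment (F n m) 0 k" for n m k
    using E_moments[of k]
    by (simp add: weights_with_moments.moment_def[OF F] F_def weight_index_def
        set_lebesgue_integral_def mult.left_commute)
  \<comment> \<open>The points of the product space are undefined outside \<open>{1..n}\<close>, as the domain of integration
    demands; only therefore is its indicator the product of the indicators of its factors.\<close>
  have integrand: "indicator (gop_domain I n m) x *\<^sub>R gop_integrand \<omega> n m x0 x
      = g n m (x(0 := x0)) * (\<Prod>i\<in>{1..n}. F n m i (x i))"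
    if x: "x \<in> space (lebesgue_pow n)" for n m x0 x
  proof -
    have "(indicator (gop_domain I n m) x :: real)
        = (\<Prod>i\<in>{1..n}. indicator (I (weight_index n m i)) (x i))"
    proof (cases "x \<in> gop_domain I n m")
      case True
      then show ?thesis
        by (auto simp: gop_domain_def PiE_def Pi_def intro!: prod.neutral[symmetric])
    next
      case False
      then obtain i where "i \<in> {1..n}" "x i \<notin> I (weight_index n m i)"
        using x by (auto simp: gop_domain_def space_PiM PiE_def Pi_def)
      then show ?thesis
        using False by (auto intro!: prod_zero[symmetric] bexI[of _ i])
    qed
    moreover have "vandermonde 1 (n - m + 1) (x(0 := x0)) = vandermonde 1 (n - m + 1) x"
      by (intro vandermonde_cong) auto
    ultimately show ?thesis
      by (simp add: g_def gop_integrand_def vandermonde_kernel_def F_def prod.distrib)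
  qed
  have insert_0: "insert 0 {1..n} = {0..n}" for n :: nat
    by auto
  have g: "g n m \<in> polyfuns (insert 0 {1..n})" if "1 \<le> m" "m \<le> n" for n m
    unfolding insert_0 g_def using that by (intro vandermonde_kernel_polyfun) auto
  have integrable: "set_integrable (lebesgue_pow n) (gop_domain I n m) (gop_integrand \<omega> n m x0)"
    if "1 \<le> m" "m \<le> n" for n m x0
  proof -
    have "integrable (lebesgue_pow n) (\<lambda>x. g n m (x(0 := x0)) * (\<Prod>i\<in>{1..n}. F n m i (x i)))"
      by (rule weights_with_moments.integrable_polyfun[OF F finite_atLeastAtMost
            polyfuns_update[OF _ _ g[OF that]]]) simp_all
    also have "?this \<longleftrightarrow> ?thesis"
      unfolding set_integrable_def
      by (intro Bochner_Integration.integrable_cong refl integrand[symmetric])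
    finally show ?thesis .
  qed
  have gop_value: "gop_value I \<omega> n m x0
      = weights_with_moments.weighted_integral (F n m) {1..n} (\<lambda>x. g n m (x(0 := x0)))" for n m x0
    unfolding gop_value_def set_lebesgue_integral_def
      weights_with_moments.weighted_integral_def[OF F]
    by (intro Bochner_Integration.integral_cong refl integrand)
  have gop_poly: "poly (gop_poly I \<omega> n m) x0 = gop_value I \<omega> n m x0 \<and>
      E (monom 1 k * gop_poly I \<omega> n m) = weights_with_moments.weighted_integral (F n m) {0..n}
        (\<lambda>x. x 0 ^ k * g n m x)"
    if nm: "1 \<le> m" "m \<le> n" for n m x0 k
  proof -
    obtain q where q: "\<And>t. poly q t = gop_value I \<omega> n m t"
      "\<And>k. E (monom 1 k * q) = weights_with_moments.weighted_integral (F n m) {0..n}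
        (\<lambda>x. x 0 ^ k * g n m x)"
      using weights_with_moments.partial_weighted_integral[OF F _ _ g[OF nm] E_linear E, of n m]
      unfolding gop_value insert_0 by auto
    have "gop_poly I \<omega> n m = q"
      unfolding gop_poly_def
      by (rule the_equality) (simp_all add: q(1) ext flip: poly_eq_poly_eq_iff)
    then show ?thesis
      using q by simp
  qed
  have "E (monom 1 k * gop_poly I \<omega> n m) = 0" if "1 \<le> m" "m \<le> n" "k \<le> n - m" for n m k
    using weighted_integral_kernel_eq_0[OF F, of "n - m + 1" n k n m] that gop_poly
    by (simp add: g_def F_def[abs_def] weight_index_def)
  then show ?thesis
    using integrable gop_poly E_linear E_1 by (simp add: generalized_ops_def)
qed

end
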